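(* Let $G$ be a connected regular $k$-partially walk-regular graph with $n$ vertices, adjacency matrix $A$, and spectrum $\{\theta_0^{m_0},\theta_1^{m_1},\ldots,\theta_d^{m_d}\}$ with $\theta_0>\theta_1>\cdots>\theta_d$. Let $k\in\{1,\ldots,d\}$ and let $f_k$ be a $k$-minor polynomial of $G$. Then the Lovász theta number of the power graph satisfies $$\vartheta(G^k)\le \operatorname{tr} f_k(A)=\sum_{i=0}^d m_i f_k(\theta_i).$$
   Context: A graph is $k$-partially walk-regular if for each $\ell\le k$ the number of closed walks of length $\ell$ rooted at a vertex does not depend on the vertex. The $k$-th power $G^k$ has the same vertex set as $G$, two distinct vertices adjacent iff their distance in $G$ is at most $k$. A $k$-minor polynomial is a polynomial $f_k\in\mathbb R_k[x]$ (degree at most $k$) with $f_k(\theta_0)=1$ and $f_k(\theta_i)=x_i$ for $1\le i\le d$, where $(x_1,\ldots,x_d)$ is an optimal solution of the linear program: minimize $\sum_{i=0}^d m_i f(\theta_i)$ subject to $f(\theta_0)=1$, $f(\theta_i)=x_i$, $f[\theta_0,\ldots,\theta_m]=0$ for $m=k+1,\ldots,d$, and $x_i\ge0$ for $i=1,\ldots,d$; here $f[\theta_i,\ldots,\theta_j]$ are Newton divided differences, $f[\theta_i]=f(\theta_i)$ and $f[\theta_i,\ldots,\theta_j]=\frac{f[\theta_{i+1},\ldots,\theta_j]-f[\theta_i,\ldots,\theta_{j-1}]}{\theta_j-\theta_i}$ (equivalently, the interpolating polynomial through the values on $\theta_0,\ldots,\theta_d$ has degree at most $k$). The Lovász theta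 number of a graph $H=(V,E)$ on $n$ vertices is $\vartheta(H)=\min_B \rho(B)$, where $B$ ranges over real symmetric $n\times n$ matrices with $b_{uv}=1$ whenever $u=v$ or $uv\notin E$, and $\rho(B)$ is the spectral radius (largest eigenvalue). *)

theory Defs
  imports
    "HOL-Analysis.Analysis"
    "HOL-Library.Extended_Nat"
    "HOL-Computational_Algebra.Polynomial"
begin

section \<open>Graphs\<close>

text \<open>A finite simple graph is given by its adjacency relation on a finite vertex type
  \<open>'v\<close>; the number of vertices \<open>n\<close> is \<open>CARD('v)\<close>.\<close>

definition simple_graph :: "'v rel \<Rightarrow> bool" where
  "simple_graph E \<longleftrightarrow> sym E \<and> irrefl E"

definition walks :: "'v rel \<Rightarrow> nat \<Rightarrow> 'v \<Rightarrow> 'v \<Rightarrow> 'v list set" where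
  "walks E l u v =
     {p. length p = Suc l \<and> hd p = u \<and> last p = v \<and> successively (\<lambda>x y. (x, y) \<in> E) p}"

definition connected_graph :: "'v rel \<Rightarrow> bool" where
  "connected_graph E \<longleftrightarrow> (\<forall>u v. \<exists>l. walks E l u v \<noteq> {})"

definition regular_graph :: "'v rel \<Rightarrow> bool" where
  "regular_graph E \<longleftrightarrow> (\<exists>r. \<forall>u. card {v. (u, v) \<in> E} = r)"

definition partially_walk_regular :: "nat \<Rightarrow> 'v rel \<Rightarrow> bool" where
  "partially_walk_regular k E \<longleftrightarrow>
     (\<forall>l\<le>k. \<forall>u v. card (walks E l u u) = card (walks E l v v))"

text \<open>The distance is \<open>\<infinity>\<close> between vertices of different components.\<close>

definition graph_dist :: "'v rel \<Rightarrow> 'v \<Rightarrow> 'v \<Rightarrow> enat" where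
  "graph_dist E u v = Inf (enat ` {l. walks E l u v \<noteq> {}})"

definition graph_power :: "'v rel \<Rightarrow> nat \<Rightarrow> 'v rel" where
  "graph_power E k = {(u, v). u \<noteq> v \<and> graph_dist E u v \<le> enat k}"


section \<open>Matrices\<close>

definition adjacency_matrix :: "'v rel \<Rightarrow> real^'v^'v" where
  "adjacency_matrix E = (\<chi> u v. if (u, v) \<in> E then 1 else 0)"

definition eigenspace :: "real^'n^'n \<Rightarrow> real \<Rightarrow> (real^'n) set" where
  "eigenspace A \<theta> = {x. A *v x = \<theta> *\<^sub>R x}"

definition eigenvalues :: "real^'n^'n \<Rightarrow> real set" where
  "eigenvalues A = {\<theta>. \<exists>x. x \<noteq> 0 \<and> A *v x = \<theta> *\<^sub>R x}"

text \<open>\<open>A\<close> has the distinct eigenvalues \<open>\<theta>\<^sub>0 > \<dots> > \<theta>\<^sub>d\<close> with multiplicities \<open>m\<^sub>0, \<dots>, m\<^sub>d\<close>.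
  This is only used for symmetric \<open>A\<close>, where geometric and algebraic multiplicity agree.\<close>

definition has_spectrum :: "real^'n^'n \<Rightarrow> nat \<Rightarrow> (nat \<Rightarrow> real) \<Rightarrow> (nat \<Rightarrow> nat) \<Rightarrow> bool" where
  "has_spectrum A d \<theta> m \<longleftrightarrow>
     (\<forall>i j. i < j \<and> j \<le> d \<longrightarrow> \<theta> j < \<theta> i) \<and>
     eigenvalues A = \<theta> ` {..d} \<and>
     (\<forall>i\<le>d. m i = dim (eigenspace A (\<theta> i)))"

definition matrix_power :: "real^'n^'n \<Rightarrow> nat \<Rightarrow> real^'n^'n" where
  "matrix_power A i = (((**) A) ^^ i) (mat 1)"

definition matrix_poly :: "real poly \<Rightarrow> real^'n^'n \<Rightarrow> real^'n^'n" where
  "matrix_poly p A = (\<Sum>i\<le>degree p. coeff p i *\<^sub>R matrix_power A i)"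

definition largest_eigenvalue :: "real^'n^'n \<Rightarrow> real" where
  "largest_eigenvalue B = Max (eigenvalues B)"


section \<open>Minor polynomials\<close>

text \<open>\<open>divided_difference f \<theta> i j\<close> is \<open>f[\<theta>\<^sub>i, \<dots>, \<theta>\<^sub>j]\<close> for \<open>i \<le> j\<close>.\<close>

function divided_difference :: "(real \<Rightarrow> real) \<Rightarrow> (nat \<Rightarrow> real) \<Rightarrow> nat \<Rightarrow> nat \<Rightarrow> real" where
  "divided_difference f \<theta> i j =
     (if j \<le> i then f (\<theta> i)
      else (divided_difference f \<theta> (i + 1) j - divided_difference f \<theta> i (j - 1)) / (\<theta> j - \<theta> i))"
  by auto
termination by (relation "Wellfounded.measure (\<lambda>(f, \<theta>, i, j). j - i)") auto

declare divided_difference.simps [simp del]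

text \<open>The linear program in the unknowns \<open>x\<^sub>1, \<dots>, x\<^sub>d\<close>; the function \<open>f\<close> only matters through
  its values on \<open>\<theta>\<^sub>0, \<dots>, \<theta>\<^sub>d\<close>, which the first two constraints express by \<open>x\<close>.\<close>

definition minor_lp_feasible ::
  "nat \<Rightarrow> (nat \<Rightarrow> real) \<Rightarrow> nat \<Rightarrow> (real \<Rightarrow> real) \<Rightarrow> (nat \<Rightarrow> real) \<Rightarrow> bool" where
  "minor_lp_feasible d \<theta> k f x \<longleftrightarrow>
     f (\<theta> 0) = 1 \<and>
     (\<forall>i\<in>{1..d}. f (\<theta> i) = x i) \<and>
     (\<forall>j\<in>{k+1..d}. divided_difference f \<theta> 0 j = 0) \<and>
     (\<forall>i\<in>{1..d}. x i \<ge> 0)"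

definition minor_lp_objective ::
  "nat \<Rightarrow> (nat \<Rightarrow> real) \<Rightarrow> (nat \<Rightarrow> nat) \<Rightarrow> (real \<Rightarrow> real) \<Rightarrow> real" where
  "minor_lp_objective d \<theta> m f = (\<Sum>i\<le>d. real (m i) * f (\<theta> i))"

definition minor_lp_optimal ::
  "nat \<Rightarrow> (nat \<Rightarrow> real) \<Rightarrow> (nat \<Rightarrow> nat) \<Rightarrow> nat \<Rightarrow> (nat \<Rightarrow> real) \<Rightarrow> bool" where
  "minor_lp_optimal d \<theta> m k x \<longleftrightarrow>
     (\<exists>f. minor_lp_feasible d \<theta> k f x \<and>
        (\<forall>g y. minor_lp_feasible d \<theta> k g y \<longrightarrow>
           minor_lp_objective d \<theta> m f \<le> minor_lp_objective d \<theta> m g))"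

definition minor_polynomial ::
  "nat \<Rightarrow> (nat \<Rightarrow> real) \<Rightarrow> (nat \<Rightarrow> nat) \<Rightarrow> nat \<Rightarrow> real poly \<Rightarrow> bool" where
  "minor_polynomial d \<theta> m k p \<longleftrightarrow>
     degree p \<le> k \<and> poly p (\<theta> 0) = 1 \<and>
     (\<exists>x. minor_lp_optimal d \<theta> m k x \<and> (\<forall>i\<in>{1..d}. poly p (\<theta> i) = x i))"


section \<open>The Lovasz theta number\<close>

definition theta_matrices :: "'v rel \<Rightarrow> (real^'v^'v) set" where
  "theta_matrices H =
     {B. transpose B = B \<and> (\<forall>u v. u = v \<or> (u, v) \<notin> H \<longrightarrow> B $ u $ v = 1)}"

text \<open>As in Lovasz's definition, the minimised quantity is the largest eigenvalue, not the
  largest absolute value of an eigenvalue. The infimum is a minimum for every \<open>H\<close>; see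
  \<open>lovasz_theta_attained\<close> below.\<close>

definition lovasz_theta :: "'v::finite rel \<Rightarrow> real" where
  "lovasz_theta H = (INF B \<in> theta_matrices H. largest_eigenvalue B)"

lemma symmetric_inner:
  fixes B :: "real^'n^'n"
  assumes "transpose B = B"
  shows "x \<bullet> (B *v y) = (B *v x) \<bullet> y"
  using assms by (metis dot_lmul_matrix transpose_matrix_vector)

lemma rayleigh_max:
  fixes B :: "real^'n^'n"
  assumes sym: "transpose B = B"
  obtains l where "l \<in> eigenvalues B" "\<And>x. x \<bullet> (B *v x) \<le> l * (x \<bullet> x)"
proof -
  let ?S = "sphere (0::real^'n) 1"
  have lin: "linear ((*v) B)" by simp
  have cont: "continuous_on ?S (\<lambda>x. x \<bullet> (B *v x))"
    by (intro continuous_intros linear_continuous_on_compose lin) 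
  have ne: "?S \<noteq> {}" by simp
  obtain v where v: "v \<in> ?S" and mx: "\<And>y. y \<in> ?S \<Longrightarrow> y \<bullet> (B *v y) \<le> v \<bullet> (B *v v)"
    using continuous_attains_sup[OF compact_sphere ne cont] by blast
  define l where "l = v \<bullet> (B *v v)"
  have vv: "v \<bullet> v = 1" using v by (simp add: norm_eq_1)
  have R: "x \<bullet> (B *v x) \<le> l * (x \<bullet> x)" for x
  proof (cases "x = 0")
    case False
    define y where "y = x /\<^sub>R norm x"
    have "y \<in> ?S" using False by (simp add: y_def)
    then have "y \<bullet> (B *v y) \<le> l" using mx l_def by blast
    moreover have "x = norm x *\<^sub>R y" using False by (simp add: y_def)
    then have "x \<bullet> (B *v x) = (norm x)\<^sup>2 * (y \<bullet> (B *v y))"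
      by (metis (no_types, lifting) inner_scaleR_left inner_scaleR_right
          matrix_vector_mult_scaleR mult.assoc power2_eq_square)
    ultimately show ?thesis
      using mult_left_mono[of "y \<bullet> (B *v y)" l "x \<bullet> x"]
      by (simp add: mult.commute power2_norm_eq_inner)
  qed simp
  define w where "w = l *\<^sub>R v - B *v v"
  have key: "0 \<le> 2 * t * (w \<bullet> w) + t\<^sup>2 * (l * (w \<bullet> w) - w \<bullet> (B *v w))" for t
  proof -
    let ?z = "v + t *\<^sub>R w"
    define a b c e where "a = w \<bullet> (B *v v)" and "b = w \<bullet> (B *v w)"
      and "c = w \<bullet> v" and "e = w \<bullet> w"
    have sym': "v \<bullet> (B *v w) = a"
      using symmetric_inner[OF sym, of v w] by (simp add: a_def inner_commute)
    have "?z \<bullet> (B *v ?z) = l + 2 * t * a + t\<^sup>2 * b"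
      using sym' unfolding a_def b_def l_def
      by (simp add: matrix_vector_right_distrib matrix_vector_mult_scaleR inner_add_left
          inner_add_right power2_eq_square distrib_left)
    moreover have "?z \<bullet> ?z = 1 + 2 * t * c + t\<^sup>2 * e"
      using vv inner_commute[of v w] unfolding c_def e_def
      by (simp add: inner_add_left inner_add_right power2_eq_square distrib_left)
    ultimately have le: "l + 2 * t * a + t\<^sup>2 * b \<le> l * (1 + 2 * t * c + t\<^sup>2 * e)"
      using R[of ?z] by simp
    have e: "e = l * c - a"
    proof -
      have "w \<bullet> w = w \<bullet> (l *\<^sub>R v - B *v v)" by (simp only: w_def)
      then show ?thesis by (simp only: a_def c_def e_def inner_diff_right inner_scaleR_right)
    qed
    have "l * (1 + 2 * t * c + t\<^sup>2 * e) - (l + 2 * t * a + t\<^sup>2 * b)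
        = 2 * t * (l * c - a) + t\<^sup>2 * (l * e - b)"
      by (simp add: algebra_simps)
    then have "0 \<le> 2 * t * e + t\<^sup>2 * (l * e - b)"
      using le unfolding e[symmetric] by linarith
    then show ?thesis by (simp add: e_def b_def)
  qed
  have "w \<bullet> w = 0"
  proof (rule ccontr)
    assume "w \<bullet> w \<noteq> 0"
    then have pos: "w \<bullet> w > 0" using inner_ge_zero[of w] by linarith
    define c where "c = l * (w \<bullet> w) - w \<bullet> (B *v w)"
    have c0: "c \<ge> 0" using R[of w] by (simp add: c_def)
    define t where "t = - (w \<bullet> w) / (c + 1)"
    have t: "t * (c + 1) = - (w \<bullet> w)" using c0 by (simp add: t_def)
    have tn: "t < 0" using pos c0 by (simp add: t_def field_simps)
    have "2 * t * (w \<bullet> w) + t\<^sup>2 * c = t * (2 * (w \<bullet> w) + t * c)"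
      by (simp add: algebra_simps power2_eq_square)
    also have "2 * (w \<bullet> w) + t * c = (w \<bullet> w) - t" using t by (simp add: distrib_left)
    also have "t * ((w \<bullet> w) - t) < 0" using tn pos by (intro mult_neg_pos) linarith+
    finally show False using key[of t] c_def by simp
  qed
  then have "B *v v = l *\<^sub>R v" by (simp add: w_def)
  moreover have "v \<noteq> 0" using vv by auto
  ultimately have "l \<in> eigenvalues B" by (auto simp: eigenvalues_def)
  then show ?thesis using R that by blast
qed

lemma finite_eigenvalues:
  fixes B :: "real^'n^'n"
  assumes sym: "transpose B = B"
  shows "finite (eigenvalues B)"
proof -
  obtain e where e: "\<And>l. l \<in> eigenvalues B \<Longrightarrow> e l \<noteq> 0 \<and> B *v e l = l *\<^sub>R e l"
  proof -
    have "\<forall>l \<in> eigenvalues B. \<exists>x. x \<noteq> 0 \<and> B *v x = l *\<^sub>R x"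
      by (auto simp: eigenvalues_def)
    then show thesis using that by (auto dest!: bchoice)
  qed
  have orth: "e l \<bullet> e l' = 0" if "l \<in> eigenvalues B" "l' \<in> eigenvalues B" "l \<noteq> l'" for l l'
  proof -
    have "l * (e l \<bullet> e l') = l' * (e l \<bullet> e l')"
      using symmetric_inner[OF sym, of "e l" "e l'"] e that by simp
    then show ?thesis using that by simp
  qed
  have inj: "inj_on e (eigenvalues B)"
    by (rule inj_onI) (metis e inner_eq_zero_iff orth)
  have "pairwise orthogonal (e ` eigenvalues B)"
    by (auto simp: pairwise_def orthogonal_def intro!: orth)
  then have "finite (e ` eigenvalues B)" by (rule pairwise_orthogonal_imp_finite)
  then show ?thesis using inj finite_imageD by blast
qed

lemma largest_eigenvalue_le_iff:
  fixes B :: "real^'n^'n"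
  assumes sym: "transpose B = B"
  shows "largest_eigenvalue B \<le> t \<longleftrightarrow> (\<forall>x. x \<bullet> (B *v x) \<le> t * (x \<bullet> x))"
proof -
  obtain l where l: "l \<in> eigenvalues B" "\<And>x. x \<bullet> (B *v x) \<le> l * (x \<bullet> x)"
    using rayleigh_max[OF sym] by blast
  have fin: "finite (eigenvalues B)" by (rule finite_eigenvalues[OF sym])
  have ub: "l' \<le> s" if R: "\<forall>x. x \<bullet> (B *v x) \<le> s * (x \<bullet> x)" and l': "l' \<in> eigenvalues B" for l' s
  proof -
    obtain x where x: "x \<noteq> 0" "B *v x = l' *\<^sub>R x" using l' by (auto simp: eigenvalues_def)
    have "l' * (x \<bullet> x) \<le> s * (x \<bullet> x)" using R[rule_format, of x] x(2) by simp
    then show ?thesis using x(1) by simp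
  qed
  have eq: "largest_eigenvalue B = l"
    unfolding largest_eigenvalue_def using fin l ub by (intro Max_eqI) auto
  show ?thesis
  proof
    assume "largest_eigenvalue B \<le> t"
    then show "\<forall>x. x \<bullet> (B *v x) \<le> t * (x \<bullet> x)"
      using l(2) eq by (meson inner_ge_zero mult_right_mono order_trans)
  next
    assume "\<forall>x. x \<bullet> (B *v x) \<le> t * (x \<bullet> x)"
    then show "largest_eigenvalue B \<le> t" using ub l(1) eq by blast
  qed
qed

lemma lovasz_theta_attained:
  fixes H :: "'v::finite rel"
  shows "\<exists>B \<in> theta_matrices H. largest_eigenvalue B = lovasz_theta H \<and>
           (\<forall>C \<in> theta_matrices H. largest_eigenvalue B \<le> largest_eigenvalue C)"
proof -
  define J :: "real^'v^'v" where "J = (\<chi> u v. 1)"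
  have J: "J \<in> theta_matrices H"
    by (simp add: theta_matrices_def J_def transpose_def)
  define M where "M = largest_eigenvalue J"
  define K where "K = {(B, t). B \<in> theta_matrices H \<and> (\<forall>x. x \<bullet> (B *v x) \<le> t * (x \<bullet> x)) \<and> t \<le> M}"
  have entry: "x \<bullet> (B *v x) = (\<Sum>u\<in>UNIV. \<Sum>v\<in>UNIV. x $ u * B $ u $ v * x $ v)"
    for x and B :: "real^'v^'v"
    by (simp add: inner_vec_def matrix_vector_mult_def sum_distrib_left mult.assoc)
  have bil: "axis u 1 \<bullet> (B *v axis v 1) = B $ u $ v" for u v and B :: "real^'v^'v"
    by (simp add: inner_axis' matrix_vector_mul_component inner_axis)
  have diag: "B $ u $ u = 1" and sB: "transpose B = B" if "B \<in> theta_matrices H" for B u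
    using that by (auto simp: theta_matrices_def)
  have t1: "t \<ge> 1" and bd: "\<bar>B $ u $ v\<bar> \<le> t" if K: "(B, t) \<in> K" for B t u v
  proof -
    have B: "B \<in> theta_matrices H" and R: "\<And>x. x \<bullet> (B *v x) \<le> t * (x \<bullet> x)"
      using K by (auto simp: K_def)
    show t1: "t \<ge> 1" using R[of "axis u 1"] bil[of u B u] diag[OF B, of u] by (simp add: inner_axis_axis)
    have s: "B $ v $ u = B $ u $ v" using sB[OF B] by (metis transpose_def vec_lambda_beta)
    show "\<bar>B $ u $ v\<bar> \<le> t"
    proof (cases "u = v")
      case True then show ?thesis using t1 diag[OF B] by simp
    next
      case False
      let ?a = "axis u 1 :: real^'v" and ?b = "axis v 1 :: real^'v"
      have "(?a + ?b) \<bullet> (B *v (?a + ?b)) = 2 + 2 * B $ u $ v"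
        using diag[OF B] s by (simp add: matrix_vector_right_distrib inner_add_left inner_add_right bil)
      moreover have "(?a + ?b) \<bullet> (?a + ?b) = 2"
        using False by (simp add: inner_add_left inner_add_right inner_axis_axis)
      moreover have "(?a - ?b) \<bullet> (B *v (?a - ?b)) = 2 - 2 * B $ u $ v"
        using diag[OF B] s by (simp add: matrix_vector_mult_diff_distrib inner_diff_left inner_diff_right bil)
      moreover have "(?a - ?b) \<bullet> (?a - ?b) = 2"
        using False by (simp add: inner_diff_left inner_diff_right inner_axis_axis)
      ultimately show ?thesis using R[of "?a + ?b"] R[of "?a - ?b"] by (simp add: abs_le_iff)
    qed
  qed
  have "closed K"
  proof -
    have 1: "closed {p::(real^'v^'v)\<times>real. u = v \<or> (u, v) \<notin> H \<longrightarrow> fst p $ u $ v = 1}" for u v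
    proof (cases "u = v \<or> (u, v) \<notin> H")
      case True
      then show ?thesis by (simp, intro closed_Collect_eq continuous_intros)
    next
      case False
      then show ?thesis by simp
    qed
    have 2: "closed {p::(real^'v^'v)\<times>real. fst p $ v $ u = fst p $ u $ v}" for u v
      by (intro closed_Collect_eq continuous_intros)
    have 3: "closed {p::(real^'v^'v)\<times>real. x \<bullet> (fst p *v x) \<le> snd p * (x \<bullet> x)}" for x
      unfolding entry by (intro closed_Collect_le continuous_intros)
    have 4: "closed {p::(real^'v^'v)\<times>real. snd p \<le> M}"
      by (intro closed_Collect_le continuous_intros)
    have "K = {p. \<forall>u v. u = v \<or> (u, v) \<notin> H \<longrightarrow> fst p $ u $ v = 1} \<inter>
              {p. \<forall>u v. fst p $ v $ u = fst p $ u $ v} \<inter>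
              {p. \<forall>x. x \<bullet> (fst p *v x) \<le> snd p * (x \<bullet> x)} \<inter> {p. snd p \<le> M}"
      by (auto simp: K_def theta_matrices_def transpose_def vec_eq_iff)
    then show ?thesis
      using 1 2 3 4 by (auto intro!: closed_Int closed_Collect_all)
  qed
  moreover have "bounded K"
  proof -
    have "norm p \<le> real CARD('v) * (real CARD('v) * M) + M" if "p \<in> K" for p
    proof -
      obtain B t where p: "p = (B, t)" by force
      have K: "(B, t) \<in> K" using that p by simp
      have tM: "t \<le> M" using K by (simp add: K_def)
      have "norm (B $ u) \<le> real CARD('v) * M" for u
      proof -
        have "norm (B $ u) \<le> (\<Sum>v\<in>UNIV. norm (B $ u $ v))" by (rule norm_le_l1_cart[unfolded real_norm_def[symmetric]])
        also have "\<dots> \<le> (\<Sum>v\<in>(UNIV::'v set). M)"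
          using bd[OF K] tM by (intro sum_mono) (metis order_trans real_norm_def)
        finally show ?thesis by simp
      qed
      then have "(\<Sum>u\<in>UNIV. norm (B $ u)) \<le> (\<Sum>u\<in>(UNIV::'v set). real CARD('v) * M)"
        by (intro sum_mono)
      moreover have "norm B \<le> (\<Sum>u\<in>UNIV. norm (B $ u))"
        unfolding norm_vec_def by (rule L2_set_le_sum) simp
      moreover have "norm t \<le> M" using t1[OF K] tM by simp
      moreover have "norm p \<le> norm B + norm t" using norm_Pair_le[of B t] by (simp add: p)
      ultimately show ?thesis by simp
    qed
    then show ?thesis unfolding bounded_iff by (intro exI ballI)
  qed
  ultimately have "compact K" by (simp add: compact_eq_bounded_closed)
  moreover have "(J, M) \<in> K"
    using J largest_eigenvalue_le_iff[OF sB[OF J], of M] by (simp add: K_def M_def)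
  then have "K \<noteq> {}" by blast
  moreover have "continuous_on K snd" by (intro continuous_intros)
  ultimately have "\<exists>p\<in>K. \<forall>q\<in>K. snd p \<le> snd q" by (rule continuous_attains_inf)
  then obtain p where p: "p \<in> K" "\<forall>q\<in>K. snd p \<le> snd q" by (elim bexE)
  obtain B t where Bt: "p = (B, t)" by force
  have B: "B \<in> theta_matrices H" and Bl: "largest_eigenvalue B \<le> t" and tM: "t \<le> M"
    using p(1) Bt largest_eigenvalue_le_iff[OF sB, of B t] by (auto simp: K_def)
  have min: "largest_eigenvalue B \<le> largest_eigenvalue C" if C: "C \<in> theta_matrices H" for C
  proof (cases "largest_eigenvalue C \<le> M")
    case True
    then have "(C, largest_eigenvalue C) \<in> K"
      using C largest_eigenvalue_le_iff[OF sB[OF C], of "largest_eigenvalue C"]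
      by (simp add: K_def)
    then have "t \<le> largest_eigenvalue C"
      using bspec[OF p(2)] Bt by force
    then show ?thesis using Bl by linarith
  next
    case False
    then show ?thesis using Bl tM by linarith
  qed
  have "lovasz_theta H = largest_eigenvalue B"
    unfolding lovasz_theta_def using B min by (intro cInf_eq_minimum) auto
  then show ?thesis using B min by auto
qed

end

theory Submission
  imports Defs
begin

text \<open>Put \<open>M = f\<^sub>k(A)\<close> and \<open>t = tr M\<close>. Partial walk-regularity makes the diagonal of \<open>M\<close> constant,
  and \<open>M\<close> vanishes at pairs of distance larger than \<open>k\<close>; hence \<open>B = t I + J - n M\<close> is an
  admissible matrix in the definition of \<open>\<vartheta>(G\<^sup>k)\<close>. Since \<open>f\<^sub>k \<ge> 0\<close> on the spectrum, \<open>M\<close> is positive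
  semidefinite, and \<open>M 1 = 1\<close> because \<open>f\<^sub>k(\<theta>\<^sub>0) = 1\<close>. The Cauchy--Schwarz inequality for the form of
  \<open>M\<close>, applied to \<open>1\<close> and \<open>x\<close>, gives \<open>(1 \<bullet> x)\<^sup>2 \<le> n (x \<bullet> M x)\<close>, which says that the largest eigenvalue
  of \<open>B\<close> is at most \<open>t\<close>.\<close>

section \<open>Spectral decomposition of symmetric matrices\<close>

definition orthonormal :: "'a::real_inner set \<Rightarrow> bool" where
  "orthonormal S \<longleftrightarrow> pairwise orthogonal S \<and> (\<forall>b\<in>S. norm b = 1)"

lemma orthonormal_inner:
  assumes "orthonormal S" "b \<in> S" "c \<in> S"
  shows "b \<bullet> c = (if b = c then 1 else 0)"
  using assms by (auto simp: orthonormal_def pairwise_def orthogonal_def norm_eq_1)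

lemma orthonormal_independent:
  assumes "orthonormal S"
  shows "independent S"
  using assms by (intro pairwise_orthogonal_independent) (auto simp: orthonormal_def)

lemma orthonormal_finite:
  fixes S :: "'a::euclidean_space set"
  assumes "orthonormal S"
  shows "finite S"
  using orthonormal_independent[OF assms] independent_bound by blast

lemma orthonormal_expansion:
  assumes on: "orthonormal S" and fin: "finite S" and x: "x \<in> span S"
  shows "x = (\<Sum>b\<in>S. (b \<bullet> x) *\<^sub>R b)"
proof -
  obtain a where a: "x = (\<Sum>b\<in>S. a b *\<^sub>R b)"
    using x fin by (auto simp: span_finite)
  have "c \<bullet> x = a c" if "c \<in> S" for c
  proof -
    have "c \<bullet> x = (\<Sum>b\<in>S. a b * (c \<bullet> b))"
      unfolding a by (simp add: inner_sum_right)
    also have "\<dots> = (\<Sum>b\<in>S. if c = b then a b else 0)"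
      using orthonormal_inner[OF on that] by (intro sum.cong) auto
    finally show ?thesis using fin that by simp
  qed
  then show ?thesis unfolding a by (intro sum.cong) auto
qed

text \<open>Deflation: subtracting a large multiple of the orthogonal projection onto the span of \<open>S\<close>
  pushes the eigenvalues belonging to \<open>S\<close> below the Rayleigh quotient of \<open>w\<close>, so that a top
  eigenvector of the modified matrix must be orthogonal to \<open>S\<close>.\<close>

lemma symmetric_eigenvector_orthogonal:
  fixes A :: "real^'n^'n"
  assumes sym: "transpose A = A" and fin: "finite S"
    and eig: "\<And>b. b \<in> S \<Longrightarrow> A *v b = l b *\<^sub>R b"
    and on: "orthonormal S"
    and w: "w \<noteq> 0" "\<And>b. b \<in> S \<Longrightarrow> b \<bullet> w = 0"
  obtains v \<mu> where "v \<noteq> 0" "A *v v = \<mu> *\<^sub>R v" "\<And>b. b \<in> S \<Longrightarrow> b \<bullet> v = 0"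
proof -
  \<comment> \<open>\<open>q\<close> is the Rayleigh quotient of \<open>w\<close>; \<open>s\<close>
    exceeds every \<open>\<bar>l b - q\<bar>\<close>, so the shifted values \<open>l b - s\<close>
    fall below \<open>q\<close>.\<close>
  define q where "q = (w \<bullet> (A *v w)) / (w \<bullet> w)"
  define s where "s = (\<Sum>b\<in>S. \<bar>l b - q\<bar>) + 1"
  have s: "l b - s < q" if "b \<in> S" for b
  proof -
    have "\<bar>l b - q\<bar> \<le> (\<Sum>b\<in>S. \<bar>l b - q\<bar>)"
      using fin that by (intro member_le_sum) auto
    then show ?thesis by (simp add: s_def)
  qed
  \<comment> \<open>The orthogonal projection onto the span of \<open>S\<close>, as a sum of outer
    products.\<close>
  define P :: "real^'n^'n" where "P = (\<chi> i j. \<Sum>b\<in>S. b $ i * b $ j)"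
  define A' where "A' = A - s *\<^sub>R P"
  have P: "P *v x = (\<Sum>b\<in>S. (b \<bullet> x) *\<^sub>R b)" for x
    by (simp add: P_def vec_eq_iff matrix_vector_mult_def inner_vec_def sum_distrib_left
        sum_distrib_right sum.swap[of _ S] mult_ac)
  have A': "A' *v x = A *v x - s *\<^sub>R (\<Sum>b\<in>S. (b \<bullet> x) *\<^sub>R b)" for x
    by (simp add: A'_def matrix_vector_mult_diff_rdistrib scaleR_matrix_vector_assoc[symmetric] P)
  have "transpose A' = A'"
    using sym by (simp add: A'_def P_def transpose_def vec_eq_iff mult.commute)
  then obtain \<mu> where \<mu>: "\<mu> \<in> eigenvalues A'" "\<And>x. x \<bullet> (A' *v x) \<le> \<mu> * (x \<bullet> x)"
    using rayleigh_max by blast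
  obtain v where v: "v \<noteq> 0" "A' *v v = \<mu> *\<^sub>R v"
    using \<mu>(1) by (auto simp: eigenvalues_def)
  \<comment> \<open>\<open>w\<close> is orthogonal to \<open>S\<close>, so \<open>A'\<close> and
    \<open>A\<close> agree on it and \<open>q\<close> is a Rayleigh quotient of \<open>A'\<close>
    too.\<close>
  have "q \<le> \<mu>"
    using \<mu>(2)[of w] w by (simp add: A' q_def divide_le_eq)
  have orth: "b \<bullet> v = 0" if "b \<in> S" for b
  proof -
    have "(\<Sum>c\<in>S. (c \<bullet> v) * (b \<bullet> c)) = (\<Sum>c\<in>S. if b = c then c \<bullet> v else 0)"
      using orthonormal_inner[OF on that] by (intro sum.cong) auto
    then have "b \<bullet> (A' *v v) = (l b - s) * (b \<bullet> v)"
      using symmetric_inner[OF sym, of b v] eig[OF that] fin that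
      by (simp add: A' inner_diff_right inner_sum_right left_diff_distrib)
    then have "(l b - s) * (b \<bullet> v) = \<mu> * (b \<bullet> v)"
      by (metis v(2) inner_scaleR_right)
    then show ?thesis using s[OF that] \<open>q \<le> \<mu>\<close> by auto
  qed
  then have "A *v v = \<mu> *\<^sub>R v" using v(2) by (simp add: A')
  then show ?thesis using that v(1) orth by blast
qed

text \<open>Take an orthonormal set of eigenvectors of maximal size; the dimension bounds its size.
  If it did not span, deflation would supply one more orthogonal eigenvector.\<close>

lemma symmetric_orthonormal_eigenbasis:
  fixes A :: "real^'n^'n"
  assumes sym: "transpose A = A"
  obtains S l where "orthonormal S" "span S = UNIV" "\<And>b. b \<in> S \<Longrightarrow> A *v b = l b *\<^sub>R b"
proof -
  define Q where "Q S \<longleftrightarrow> orthonormal S \<and> (\<forall>b\<in>S. \<exists>\<mu>. A *v b = \<mu> *\<^sub>R b)" for S :: "(real^'n) set"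
  have bound: "finite S \<and> card S \<le> DIM(real^'n)" if "Q S" for S
    using that independent_bound[OF orthonormal_independent, of S] by (simp add: Q_def)
  have Q0: "Q {}" by (simp add: Q_def orthonormal_def)
  \<comment> \<open>The existence rule for a maximum asks for a strict upper bound, hence the
    successor of the dimension.\<close>
  have "\<exists>S. Q S \<and> (\<forall>T. Q T \<longrightarrow> card T \<le> card S)"
    using Q0 bound
    by (intro Lattices_Big.ex_has_greatest_nat[where b = "Suc DIM(real^'n)"]) (auto simp: less_Suc_eq_le)
  then obtain S where S: "Q S" and mx: "\<And>T. Q T \<Longrightarrow> card T \<le> card S" by blast
  have on: "orthonormal S" and fin: "finite S" using S bound by (auto simp: Q_def)
  obtain l where l: "\<And>b. b \<in> S \<Longrightarrow> A *v b = l b *\<^sub>R b"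
    using S unfolding Q_def by metis
  have "span S = UNIV"
  proof (rule ccontr)
    assume "span S \<noteq> UNIV"
    then have "span S \<subset> span UNIV" by auto
    then obtain w where w: "w \<noteq> 0" "\<And>y. y \<in> span S \<Longrightarrow> orthogonal w y"
      using orthogonal_to_subspace_exists_gen by metis
    then have "b \<bullet> w = 0" if "b \<in> S" for b
      using that span_base[of b S] by (auto simp: orthogonal_def inner_commute)
    then obtain v \<mu> where v: "v \<noteq> 0" "A *v v = \<mu> *\<^sub>R v" "\<And>b. b \<in> S \<Longrightarrow> b \<bullet> v = 0"
      using symmetric_eigenvector_orthogonal[OF sym fin l on w(1)] by metis
    define u where "u = v /\<^sub>R norm v"
    have u: "norm u = 1" "A *v u = \<mu> *\<^sub>R u" "\<And>b. b \<in> S \<Longrightarrow> b \<bullet> u = 0"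
      using v by (auto simp: u_def matrix_vector_mult_scaleR)
    have "u \<notin> S" using u(1,3) by (metis norm_eq_1 zero_neq_one)
    moreover have "Q (insert u S)"
      using S u by (auto simp: Q_def orthonormal_def pairwise_insert orthogonal_def inner_commute)
    ultimately show False using mx[of "insert u S"] fin by simp
  qed
  then show ?thesis using that on l by blast
qed

lemma orthonormal_parseval:
  assumes "orthonormal S" "finite S" "span S = UNIV"
  shows "x \<bullet> y = (\<Sum>b\<in>S. (b \<bullet> x) * (b \<bullet> y))"
proof -
  have "x \<bullet> y = (\<Sum>b\<in>S. (b \<bullet> x) *\<^sub>R b) \<bullet> y"
    using orthonormal_expansion[OF assms(1,2), of x] assms(3) by simp
  then show ?thesis by (simp add: inner_sum_left)
qed

text \<open>Parseval for row \<open>i\<close> of \<open>M\<close> and the \<open>i\<close>-th unit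
  vector expands the diagonal entry; summing over \<open>i\<close> and exchanging the sums leaves
  the quadratic form on the basis.\<close>

lemma trace_orthonormal_basis:
  fixes M :: "real^'n^'n"
  assumes on: "orthonormal S" and sp: "span S = UNIV"
  shows "trace M = (\<Sum>b\<in>S. b \<bullet> (M *v b))"
proof -
  have fin: "finite S" by (rule orthonormal_finite[OF on])
  have "M $ i $ i = (\<Sum>b\<in>S. b $ i * (M *v b) $ i)" for i
  proof -
    have "M $ i $ i = row i M \<bullet> axis i 1" by (simp add: row_def inner_axis)
    also have "\<dots> = (\<Sum>b\<in>S. (b \<bullet> row i M) * (b \<bullet> axis i 1))"
      by (rule orthonormal_parseval[OF on fin sp])
    finally show ?thesis
      by (simp add: inner_axis matrix_vector_mul_component row_def inner_commute mult.commute)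
  qed
  then show ?thesis
    by (simp add: trace_def inner_vec_def sum.swap[of _ S])
qed

lemma dim_eigenspace_eigenbasis:
  fixes A :: "real^'n^'n"
  assumes sym: "transpose A = A" and on: "orthonormal S" and sp: "span S = UNIV"
    and l: "\<And>b. b \<in> S \<Longrightarrow> A *v b = l b *\<^sub>R b"
  shows "dim (eigenspace A \<mu>) = card {b\<in>S. l b = \<mu>}"
proof -
  have fin: "finite S" by (rule orthonormal_finite[OF on])
  let ?T = "{b\<in>S. l b = \<mu>}"
  have "x \<in> span ?T" if "x \<in> eigenspace A \<mu>" for x
  proof -
    \<comment> \<open>By symmetry
      \<open>l b * (b \<bullet> x) = \<mu> * (b \<bullet> x)\<close>.\<close>
    have z: "b \<bullet> x = 0" if "b \<in> S" "l b \<noteq> \<mu>" for b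
      using symmetric_inner[OF sym, of b x] l[OF that(1)] that(2) \<open>x \<in> eigenspace A \<mu>\<close>
      by (simp add: eigenspace_def)
    have "x = (\<Sum>b\<in>S. (b \<bullet> x) *\<^sub>R b)"
      using orthonormal_expansion[OF on fin, of x] sp by simp
    also have "\<dots> = (\<Sum>b\<in>?T. (b \<bullet> x) *\<^sub>R b)"
      using fin z by (intro sum.mono_neutral_right) auto
    also have "\<dots> \<in> span ?T" by (intro span_sum span_scale span_base)
    finally show ?thesis .
  qed
  moreover have "?T \<subseteq> eigenspace A \<mu>" using l by (auto simp: eigenspace_def)
  moreover have "independent ?T"
    using orthonormal_independent[OF on] by (rule independent_mono) auto
  ultimately show ?thesis by (intro dim_unique[of ?T]) auto
qed

section \<open>Polynomials of a matrix\<close>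

lemma matrix_power_Suc: "matrix_power A (Suc i) = A ** matrix_power A i"
  by (simp add: matrix_power_def)

text \<open>Powers grow by a factor on the left, but transposing a product moves that factor to the
  right; commutation moves it back.\<close>

lemma matrix_power_commute: "matrix_power A i ** A = A ** matrix_power A i"
  by (induction i) (simp_all add: matrix_power_def matrix_mul_assoc[symmetric])

lemma transpose_matrix_power:
  assumes "transpose A = A"
  shows "transpose (matrix_power A i) = matrix_power A i"
proof (induction i)
  case 0
  then show ?case by (simp add: matrix_power_def)
next
  case (Suc i)
  then show ?case
    by (simp add: matrix_power_Suc matrix_transpose_mul assms matrix_power_commute)
qed

lemma matrix_poly_nth:
  "matrix_poly p A $ u $ v = (\<Sum>i\<le>degree p. coeff p i * matrix_power A i $ u $ v)"
  by (simp add: matrix_poly_def)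

lemma transpose_matrix_poly:
  assumes "transpose A = A"
  shows "transpose (matrix_poly p A) = matrix_poly p A"
  using transpose_matrix_power[OF assms]
  by (simp add: vec_eq_iff transpose_def matrix_poly_nth)

lemma matrix_power_eigenvector:
  assumes "A *v x = \<mu> *\<^sub>R x"
  shows "matrix_power A i *v x = \<mu> ^ i *\<^sub>R x"
proof (induction i)
  case 0
  then show ?case by (simp add: matrix_power_def)
next
  case (Suc i)
  then show ?case
    by (simp add: matrix_power_Suc matrix_vector_mul_assoc[symmetric] matrix_vector_mult_scaleR
        assms mult.commute)
qed

lemma matrix_vector_mult_sum_rdistrib:
  fixes M :: "'i \<Rightarrow> real^'n^'m"
  shows "(\<Sum>i\<in>I. M i) *v x = (\<Sum>i\<in>I. M i *v x)"
  by (induction I rule: infinite_finite_induct)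
     (simp_all add: matrix_vector_mult_add_rdistrib)

lemma matrix_poly_eigenvector:
  assumes "A *v x = \<mu> *\<^sub>R x"
  shows "matrix_poly p A *v x = poly p \<mu> *\<^sub>R x"
  by (simp add: matrix_poly_def matrix_vector_mult_sum_rdistrib
      scaleR_matrix_vector_assoc[symmetric] matrix_power_eigenvector[OF assms]
      poly_altdef scaleR_sum_left)

lemma eigenbasis_eigenvalue:
  fixes A :: "real^'n^'n"
  assumes "orthonormal S" "b \<in> S" "A *v b = \<mu> *\<^sub>R b"
  shows "\<mu> \<in> eigenvalues A"
  using assms by (auto simp: eigenvalues_def orthonormal_def intro!: exI[of _ b])

text \<open>In an eigenbasis of \<open>A\<close> the trace is the sum of \<open>poly p\<close> over
  the eigenvalues of the basis vectors. Grouping these by eigenvalue yields the multiplicities as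
  class sizes.\<close>

lemma trace_matrix_poly_spectrum:
  fixes A :: "real^'n^'n"
  assumes sym: "transpose A = A" and spec: "has_spectrum A d \<theta> m"
  shows "trace (matrix_poly p A) = (\<Sum>i\<le>d. real (m i) * poly p (\<theta> i))"
proof -
  obtain S l where on: "orthonormal S" and sp: "span S = UNIV"
    and l: "\<And>b. b \<in> S \<Longrightarrow> A *v b = l b *\<^sub>R b"
    using symmetric_orthonormal_eigenbasis[OF sym] by blast
  have fin: "finite S" by (rule orthonormal_finite[OF on])
  \<comment> \<open>Strict decrease makes the \<open>\<theta> i\<close> distinct, so a sum over the
    set of eigenvalues can be reindexed by \<open>i\<close>.\<close>
  have inj: "inj_on \<theta> {..d}"
  proof (rule inj_onI)
    fix i j assume "i \<in> {..d}" "j \<in> {..d}" "\<theta> i = \<theta> j"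
    then show "i = j"
      using spec unfolding has_spectrum_def by (metis atMost_iff linorder_neqE_nat order_less_irrefl)
  qed
  have sub: "l ` S \<subseteq> \<theta> ` {..d}"
    using eigenbasis_eigenvalue[OF on _ l] spec by (auto simp: has_spectrum_def)
  have "trace (matrix_poly p A) = (\<Sum>b\<in>S. poly p (l b))"
    unfolding trace_orthonormal_basis[OF on sp]
    using orthonormal_inner[OF on] by (intro sum.cong) (simp_all add: matrix_poly_eigenvector[OF l])
  also have "\<dots> = (\<Sum>\<mu>\<in>\<theta> ` {..d}. \<Sum>b\<in>{b\<in>S. l b = \<mu>}. poly p (l b))"
    using sum.group[OF fin _ sub, of "\<lambda>b. poly p (l b)"] by simp
  also have "\<dots> = (\<Sum>\<mu>\<in>\<theta> ` {..d}. real (dim (eigenspace A \<mu>)) * poly p \<mu>)"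
    by (intro sum.cong) (simp_all add: dim_eigenspace_eigenbasis[OF sym on sp l])
  also have "\<dots> = (\<Sum>i\<le>d. real (m i) * poly p (\<theta> i))"
    using spec by (simp add: sum.reindex[OF inj] has_spectrum_def)
  finally show ?thesis .
qed

text \<open>An eigenbasis of \<open>A\<close> diagonalises the form: it becomes the sum of
  \<open>poly p (l b) * (b \<bullet> x)\<^sup>2\<close>.\<close>

lemma matrix_poly_psd:
  fixes A :: "real^'n^'n"
  assumes sym: "transpose A = A" and nn: "\<And>\<mu>. \<mu> \<in> eigenvalues A \<Longrightarrow> poly p \<mu> \<ge> 0"
  shows "x \<bullet> (matrix_poly p A *v x) \<ge> 0"
proof -
  obtain S l where on: "orthonormal S" and sp: "span S = UNIV"
    and l: "\<And>b. b \<in> S \<Longrightarrow> A *v b = l b *\<^sub>R b"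
    using symmetric_orthonormal_eigenbasis[OF sym] by blast
  have fin: "finite S" by (rule orthonormal_finite[OF on])
  have "x \<bullet> (matrix_poly p A *v x) = (\<Sum>b\<in>S. (b \<bullet> x) * (b \<bullet> (matrix_poly p A *v x)))"
    by (rule orthonormal_parseval[OF on fin sp])
  also have "\<dots> = (\<Sum>b\<in>S. poly p (l b) * (b \<bullet> x)\<^sup>2)"
    using symmetric_inner[OF transpose_matrix_poly[OF sym]]
    by (intro sum.cong) (simp_all add: matrix_poly_eigenvector[OF l] power2_eq_square)
  also have "\<dots> \<ge> 0"
    using nn eigenbasis_eigenvalue[OF on _ l] by (intro sum_nonneg mult_nonneg_nonneg) auto
  finally show ?thesis .
qed

text \<open>The form of \<open>M\<close> may be degenerate, so it need not be an inner product; the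
  inequality is read off from the nonnegative binary form in \<open>s\<close> and
  \<open>t\<close>.\<close>

lemma psd_cauchy_schwarz:
  fixes M :: "real^'n^'n"
  assumes sym: "transpose M = M" and psd: "\<And>x. x \<bullet> (M *v x) \<ge> 0"
  shows "(x \<bullet> (M *v y))\<^sup>2 \<le> (x \<bullet> (M *v x)) * (y \<bullet> (M *v y))"
proof -
  define a b c where "a = x \<bullet> (M *v x)" and "b = x \<bullet> (M *v y)" and "c = y \<bullet> (M *v y)"
  have b': "y \<bullet> (M *v x) = b"
    using symmetric_inner[OF sym, of y x] by (simp add: b_def inner_commute)
  have q: "0 \<le> s\<^sup>2 * a + 2 * s * t * b + t\<^sup>2 * c" for s t
  proof -
    have "(s *\<^sub>R x + t *\<^sub>R y) \<bullet> (M *v (s *\<^sub>R x + t *\<^sub>R y)) = s\<^sup>2 * a + 2 * s * t * b + t\<^sup>2 * c"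
      using b' by (simp add: matrix_vector_right_distrib matrix_vector_mult_scaleR inner_add_left
          inner_add_right power2_eq_square a_def b_def c_def algebra_simps)
    then show ?thesis using psd by metis
  qed
  have a0: "a \<ge> 0" and c0: "c \<ge> 0" using psd by (auto simp: a_def c_def)
  have "b\<^sup>2 \<le> a * c"
  proof (cases "a = 0")
    case False
    \<comment> \<open>At \<open>s = -b\<close>, \<open>t = a\<close> the binary form equals
      \<open>a * (a * c - b\<^sup>2)\<close>.\<close>
    have "0 \<le> a * (a * c - b\<^sup>2)"
      using q[of "-b" a] by (simp add: algebra_simps power2_eq_square)
    then show ?thesis using False a0 by (simp add: zero_le_mult_iff)
  next
    case True
    have "b = 0"
    proof (rule ccontr)
      assume "b \<noteq> 0"
      \<comment> \<open>With \<open>a = 0\<close> and \<open>t = 1\<close> the form is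
        \<open>2 * s * b + c\<close>; this \<open>s\<close> makes it \<open>-1\<close>.\<close>
      then have "2 * (- (c + 1) / (2 * b)) * b = - (c + 1)" by simp
      then show False using q[of "- (c + 1) / (2 * b)" 1] True by simp
    qed
    then show ?thesis using True by simp
  qed
  then show ?thesis by (simp add: a_def b_def c_def)
qed

section \<open>Walks and regularity\<close>

lemma finite_walks: "finite (walks (E :: 'v::finite rel) l u v)"
  by (rule finite_subset[OF _ finite_lists_length_eq[of UNIV "Suc l"]]) (auto simp: walks_def)

lemma walks_0: "walks E 0 u v = (if u = v then {[u]} else {})"
  by (auto simp: walks_def length_Suc_conv)

lemma walks_Suc: "walks E (Suc l) u v = (\<Union>w\<in>{w. (u, w) \<in> E}. (#) u ` walks E l w v)"
proof (rule set_eqI)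
  fix p
  show "p \<in> walks E (Suc l) u v \<longleftrightarrow> p \<in> (\<Union>w\<in>{w. (u, w) \<in> E}. (#) u ` walks E l w v)"
  proof (cases p)
    case Nil
    then show ?thesis by (auto simp: walks_def)
  next
    case (Cons a q)
    then show ?thesis by (cases q) (auto simp: walks_def image_iff)
  qed
qed

text \<open>Splitting off the first step of a walk corresponds to multiplying by the adjacency
  matrix on the left; the start vertex therefore varies in the induction.\<close>

lemma adjacency_matrix_power_nth:
  fixes E :: "'v::finite rel"
  shows "matrix_power (adjacency_matrix E) l $ u $ v = real (card (walks E l u v))"
proof (induction l arbitrary: u)
  case 0
  then show ?case by (simp add: matrix_power_def walks_0 mat_def)
next
  case (Suc l)
  \<comment> \<open>The union is disjoint because walks from different \<open>w\<close> have
    different heads.\<close>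
  have "card (walks E (Suc l) u v) = (\<Sum>w\<in>{w. (u, w) \<in> E}. card ((#) u ` walks E l w v))"
    unfolding walks_Suc
    by (intro card_UN_disjoint) (auto simp: finite_walks, auto simp: walks_def)
  also have "\<dots> = (\<Sum>w\<in>{w. (u, w) \<in> E}. card (walks E l w v))"
    by (simp add: card_image)
  finally have "real (card (walks E (Suc l) u v))
      = (\<Sum>w\<in>{w. (u, w) \<in> E}. real (card (walks E l w v)))" by simp
  also have "\<dots> = (\<Sum>w\<in>UNIV. if (u, w) \<in> E then real (card (walks E l w v)) else 0)"
    by (simp add: sum.If_cases)
  also have "\<dots> = matrix_power (adjacency_matrix E) (Suc l) $ u $ v"
    unfolding matrix_power_Suc matrix_matrix_mult_def
    by (auto simp: Suc[symmetric] adjacency_matrix_def intro!: sum.cong)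
  finally show ?case by simp
qed

text \<open>A walk of length \<open>l\<close> bounds the distance by \<open>l\<close>. This makes a
  polynomial of degree at most \<open>k\<close> in the adjacency matrix vanish at distinct vertices
  not adjacent in the power graph.\<close>

lemma walks_empty_if_not_power_adjacent:
  assumes "(u, v) \<notin> graph_power E k" "u \<noteq> v" "l \<le> k"
  shows "walks E l u v = {}"
proof (rule ccontr)
  assume "walks E l u v \<noteq> {}"
  then have "graph_dist E u v \<le> enat l"
    unfolding graph_dist_def by (intro Inf_lower) auto
  also have "\<dots> \<le> enat k" using assms(3) by simp
  finally show False using assms(1,2) by (simp add: graph_power_def)
qed

lemma transpose_adjacency_matrix:
  assumes "simple_graph E"
  shows "transpose (adjacency_matrix E) = adjacency_matrix E"
  using assms by (auto simp: simple_graph_def adjacency_matrix_def transpose_def vec_eq_iff sym_def)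

lemma adjacency_matrix_mult_nth:
  fixes E :: "'v::finite rel"
  shows "(adjacency_matrix E *v x) $ u = (\<Sum>v\<in>{v. (u, v) \<in> E}. x $ v)"
proof -
  have "(adjacency_matrix E *v x) $ u = (\<Sum>v\<in>UNIV. if (u, v) \<in> E then x $ v else 0)"
    by (auto simp: adjacency_matrix_def matrix_vector_mult_def intro!: sum.cong)
  then show ?thesis by (simp add: sum.If_cases)
qed

section \<open>The largest eigenvalue of a regular graph\<close>

lemma regular_adjacency_one:
  fixes E :: "'v::finite rel"
  assumes "\<And>u. card {v. (u, v) \<in> E} = r"
  shows "adjacency_matrix E *v 1 = real r *\<^sub>R 1"
  by (simp add: vec_eq_iff adjacency_matrix_mult_nth assms)

text \<open>Evaluate the eigenvector equation at an entry of largest absolute value: its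
  \<open>r\<close> neighbouring entries are no larger, and it is nonzero.\<close>

lemma regular_eigenvalue_le:
  fixes E :: "'v::finite rel"
  assumes reg: "\<And>u. card {v. (u, v) \<in> E} = r" and \<mu>: "\<mu> \<in> eigenvalues (adjacency_matrix E)"
  shows "\<mu> \<le> real r"
proof -
  obtain x where x: "x \<noteq> 0" "adjacency_matrix E *v x = \<mu> *\<^sub>R x"
    using \<mu> by (auto simp: eigenvalues_def)
  have "Max (range (\<lambda>v. \<bar>x $ v\<bar>)) \<in> range (\<lambda>v. \<bar>x $ v\<bar>)" by (intro Max_in) auto
  then obtain u where "Max (range (\<lambda>v. \<bar>x $ v\<bar>)) = \<bar>x $ u\<bar>" by blast
  then have u: "\<bar>x $ v\<bar> \<le> \<bar>x $ u\<bar>" for v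
    using Max_ge[of "range (\<lambda>v. \<bar>x $ v\<bar>)" "\<bar>x $ v\<bar>"] by simp
  have pos: "\<bar>x $ u\<bar> > 0"
  proof (rule ccontr)
    assume "\<not> \<bar>x $ u\<bar> > 0"
    then have "x $ v = 0" for v using u[of v] by simp
    then show False using x(1) by (simp add: vec_eq_iff)
  qed
  have "\<mu> * x $ u = (\<Sum>v\<in>{v. (u, v) \<in> E}. x $ v)"
    using arg_cong[OF x(2), of "\<lambda>y. y $ u"] by (simp add: adjacency_matrix_mult_nth)
  then have "\<bar>\<mu>\<bar> * \<bar>x $ u\<bar> = \<bar>\<Sum>v\<in>{v. (u, v) \<in> E}. x $ v\<bar>" by (simp flip: abs_mult)
  also have "\<dots> \<le> (\<Sum>v\<in>{v. (u, v) \<in> E}. \<bar>x $ v\<bar>)" by (rule sum_abs)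
  also have "\<dots> \<le> (\<Sum>v\<in>{v. (u, v) \<in> E}. \<bar>x $ u\<bar>)" by (intro sum_mono u)
  also have "\<dots> = real r * \<bar>x $ u\<bar>" by (simp add: reg)
  finally show ?thesis using pos by simp
qed

text \<open>Identifies \<open>\<theta> 0\<close> as the eigenvalue of the all-ones vector, so that a
  polynomial with value 1 at \<open>\<theta> 0\<close> gives a matrix fixing that vector.\<close>

lemma regular_spectrum_head:
  fixes E :: "'v::finite rel"
  assumes reg: "\<And>u. card {v. (u, v) \<in> E} = r" and spec: "has_spectrum (adjacency_matrix E) d \<theta> m"
  shows "\<theta> 0 = real r"
proof (rule antisym)
  have ev: "eigenvalues (adjacency_matrix E) = \<theta> ` {..d}"
    using spec by (simp add: has_spectrum_def)
  then show "\<theta> 0 \<le> real r" using regular_eigenvalue_le[OF reg] by auto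
  have "real r \<in> eigenvalues (adjacency_matrix E)"
    using regular_adjacency_one[OF reg] by (auto simp: eigenvalues_def intro!: exI[of _ 1])
  then obtain i where i: "i \<le> d" "real r = \<theta> i" using ev by auto
  then show "real r \<le> \<theta> 0"
    using spec unfolding has_spectrum_def by (cases "i = 0") (auto intro: less_imp_le)
qed

section \<open>The bound\<close>

lemma lovasz_theta_le:
  assumes B: "B \<in> theta_matrices H" and R: "\<And>x. x \<bullet> (B *v x) \<le> t * (x \<bullet> x)"
  shows "lovasz_theta H \<le> t"
proof -
  have "lovasz_theta H \<le> largest_eigenvalue B"
    using lovasz_theta_attained[of H] B by metis
  also have "\<dots> \<le> t"
    using B R by (subst largest_eigenvalue_le_iff) (auto simp: theta_matrices_def)
  finally show ?thesis .
qed

lemma lovasz_theta_le_trace: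
  fixes M :: "real^'v::finite^'v"
  assumes sym: "transpose M = M" and psd: "\<And>x. x \<bullet> (M *v x) \<ge> 0" and one: "M *v 1 = 1"
    and diag: "\<And>u v. M $ u $ u = M $ v $ v"
    and zero: "\<And>u v. u \<noteq> v \<Longrightarrow> (u, v) \<notin> H \<Longrightarrow> M $ u $ v = 0"
  shows "lovasz_theta H \<le> trace M"
proof -
  define n where "n = real CARD('v)"
  define J :: "real^'v^'v" where "J = (\<chi> u v. 1)"
  define B where "B = trace M *\<^sub>R mat 1 + J - n *\<^sub>R M"
  \<comment> \<open>This equality cancels the first and last terms of \<open>B\<close> on the
    diagonal, leaving the entry 1 of \<open>J\<close>.\<close>
  have tr: "trace M = n * M $ u $ u" for u
  proof -
    have "trace M = (\<Sum>v\<in>(UNIV::'v set). M $ u $ u)"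
      unfolding trace_def by (intro sum.cong diag refl)
    then show ?thesis by (simp add: n_def)
  qed
  have "transpose B = B"
    using sym by (simp add: B_def J_def transpose_def vec_eq_iff mat_def)
  moreover have "B $ u $ v = 1" if "u = v \<or> (u, v) \<notin> H" for u v
    using that tr[of u] zero[of u v] by (cases "u = v") (auto simp: B_def J_def mat_def)
  ultimately have "B \<in> theta_matrices H" by (simp add: theta_matrices_def)
  moreover have "x \<bullet> (B *v x) \<le> trace M * (x \<bullet> x)" for x
  proof -
    have J: "J *v x = (1 \<bullet> x) *\<^sub>R 1"
      by (simp add: J_def vec_eq_iff matrix_vector_mult_def inner_vec_def)
    have "x \<bullet> (B *v x) = trace M * (x \<bullet> x) + (1 \<bullet> x)\<^sup>2 - n * (x \<bullet> (M *v x))"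
      by (simp add: B_def matrix_vector_mult_diff_rdistrib matrix_vector_mult_add_rdistrib
          scaleR_matrix_vector_assoc[symmetric] J inner_diff_right inner_add_right
          power2_eq_square inner_commute)
    \<comment> \<open>Since \<open>M\<close> fixes the all-ones vector,
      \<open>1 \<bullet> (M *v x) = 1 \<bullet> x\<close> and
      \<open>1 \<bullet> (M *v 1) = n\<close>.\<close>
    moreover have "(1 \<bullet> x)\<^sup>2 \<le> n * (x \<bullet> (M *v x))"
    proof -
      have "1 \<bullet> (M *v x) = 1 \<bullet> x" using symmetric_inner[OF sym, of 1 x] one by simp
      moreover have "(1::real^'v) \<bullet> 1 = n" by (simp add: inner_vec_def n_def)
      ultimately show ?thesis using psd_cauchy_schwarz[OF sym psd, of 1 x] one by simp
    qed
    ultimately show ?thesis by linarith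
  qed
  ultimately show ?thesis by (rule lovasz_theta_le)
qed

theorem theorem3p6:
  fixes E :: "'v::finite rel" and A :: "real^'v^'v"
    and d k :: nat and \<theta> :: "nat \<Rightarrow> real" and m :: "nat \<Rightarrow> nat" and f :: "real poly"
  assumes "simple_graph E" and "connected_graph E" and "regular_graph E"
    and "partially_walk_regular k E"
    and "A = adjacency_matrix E"
    and "has_spectrum A d \<theta> m"
    and "k \<in> {1..d}"
    and "minor_polynomial d \<theta> m k f"
  shows "lovasz_theta (graph_power E k) \<le> trace (matrix_poly f A) \<and>
         trace (matrix_poly f A) = (\<Sum>i\<le>d. real (m i) * poly f (\<theta> i))"
proof
  have sym: "transpose A = A" using assms by (simp add: transpose_adjacency_matrix)
  show "trace (matrix_poly f A) = (\<Sum>i\<le>d. real (m i) * poly f (\<theta> i))"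
    by (rule trace_matrix_poly_spectrum[OF sym assms(6)])
  obtain r where reg: "\<And>u. card {v. (u, v) \<in> E} = r"
    using assms(3) by (auto simp: regular_graph_def)
  have deg: "degree f \<le> k" and f0: "poly f (\<theta> 0) = 1"
    using assms(8) by (auto simp: minor_polynomial_def)
  \<comment> \<open>The values of \<open>f\<close> at these points form a feasible solution, so the
    sign constraints of the linear program apply.\<close>
  have fi: "poly f (\<theta> i) \<ge> 0" if "i \<in> {1..d}" for i
    using assms(8) that
    by (fastforce simp: minor_polynomial_def minor_lp_optimal_def minor_lp_feasible_def)
  have nn: "poly f \<mu> \<ge> 0" if "\<mu> \<in> eigenvalues A" for \<mu>
  proof -
    have "\<mu> \<in> \<theta> ` {..d}" using that assms(6) by (simp add: has_spectrum_def)
    then obtain i where "i \<le> d" "\<mu> = \<theta> i" by auto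
    then show ?thesis using f0 fi[of i] by (cases "i = 0") auto
  qed
  \<comment> \<open>Only walks of length at most \<open>degree f \<le> k\<close> occur. Hence
    walk-regularity up to \<open>k\<close> fixes the diagonal, and distance beyond \<open>k\<close>
    forces zeros.\<close>
  have entry: "matrix_poly f A $ u $ v = (\<Sum>i\<le>degree f. coeff f i * real (card (walks E i u v)))"
    for u v by (simp add: matrix_poly_nth assms(5) adjacency_matrix_power_nth)
  show "lovasz_theta (graph_power E k) \<le> trace (matrix_poly f A)"
  proof (rule lovasz_theta_le_trace)
    show "transpose (matrix_poly f A) = matrix_poly f A" by (rule transpose_matrix_poly[OF sym])
    show "x \<bullet> (matrix_poly f A *v x) \<ge> 0" for x by (rule matrix_poly_psd[OF sym nn])
    have "\<theta> 0 = real r" using regular_spectrum_head[OF reg] assms(5,6) by blast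
    then show "matrix_poly f A *v 1 = 1"
      using matrix_poly_eigenvector[OF regular_adjacency_one[OF reg], of f] f0 assms(5) by simp
    show "matrix_poly f A $ u $ u = matrix_poly f A $ v $ v" for u v
    proof -
      have "card (walks E i u u) = card (walks E i v v)" if "i \<le> degree f" for i
        using assms(4) that deg unfolding partially_walk_regular_def by (meson order_trans)
      then show ?thesis unfolding entry by (intro sum.cong) auto
    qed
    show "matrix_poly f A $ u $ v = 0" if "u \<noteq> v" "(u, v) \<notin> graph_power E k" for u v
      unfolding entry using walks_empty_if_not_power_adjacent[OF that(2,1)] deg
      by (intro sum.neutral) auto
  qed
qed

end
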